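(* (Deduction theorem for $\mathbf{vD}$.) For all $\Gamma\cup\{\alpha,\beta\}\subseteq\mathcal{L}$: $\Gamma\cup\{\alpha\}\vdash_{\mathbf{vD}}\beta$ if and only if $\Gamma\vdash_{\mathbf{vD}}\alpha\longrightarrow\beta$.
   Context: Let $V$ be a denumerable set of propositional variables and $\mathcal{L}$ the set of formulas generated from $V$ by the binary connectives $\land,\lor,\longrightarrow$ and the unary connectives $\neg,\circ$. Fix a formula $\beta_0$ and set $\bot:=\beta_0\land(\neg\beta_0\land\circ\beta_0)$; for every formula $\alpha$ let $\sim\alpha$ abbreviate $\alpha\longrightarrow\bot$. The logic $\mathbf{vD}=\langle\mathcal{L},\vdash_{\mathbf{vD}}\rangle$ has the following axiom schemas (for all $\alpha,\beta,\gamma\in\mathcal{L}$): (1) $\alpha\to(\beta\to\alpha)$; (2) $(\alpha\to(\beta\to\gamma))\to((\alpha\to\beta)\to(\alpha\to\gamma))$; (3) $\alpha\to(\beta\to(\alpha\land\beta))$; (4) $(\alpha\land\beta)\to\alpha$; (5) $(\alpha\land\beta)\to\beta$; (6) $\alpha\to(\alpha\lor\beta)$; (7) $\beta\to(\alpha\lor\beta)$; (8) $(\alpha\to\beta)\lor\alpha$; (9) $\alpha\lor\neg\alpha$; (10) $(\alpha\to\gamma)\to((\neg\alpha\to\gamma)\to((\alpha\lor\neg\alpha)\to\gamma))$; (11) $((\alpha\to\beta)\to\gamma)\to((\alpha\to\gamma)\to(((\alpha\to\beta)\lor\alpha)\to\gamma))$; (12) $\circ\alpha\to(\alpha\to(\neg\alpha\to\beta))$;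 (13) $\circ\alpha\lor(\alpha\land\neg\alpha)$; (14) $(\circ\alpha\to\gamma)\to(((\alpha\land\neg\alpha)\to\gamma)\to((\circ\alpha\lor(\alpha\land\neg\alpha))\to\gamma))$; (15) $\sim\neg\alpha\to\sim\neg\sim\neg\alpha$; (16) $\sim\neg\sim\neg\alpha\to\sim\neg\alpha$; (17) $\sim\neg(\alpha\land\beta)\to(\sim\neg\alpha\land\sim\neg\beta)$; (18) $(\sim\neg\alpha\land\sim\neg\beta)\to\sim\neg(\alpha\land\beta)$ (here $\to$ denotes $\longrightarrow$). Rules: (MP) from $\alpha$ and $\alpha\longrightarrow\beta$ infer $\beta$; (N) from $\alpha$ infer $\neg\alpha\longrightarrow\sim\alpha$, applicable only when $\alpha$ is a theorem. A derivation of $\varphi$ from $\Gamma$ is a finite sequence $\varphi_1,\dots,\varphi_n=\varphi$ where each $\varphi_i$ is an axiom instance, or belongs to $\Gamma$, or follows by MP from earlier members, or is obtained by (N) from an earlier $\varphi_j$ which is a theorem. $\Gamma\vdash_{\mathbf{vD}}\varphi$ means such a derivation exists; $\varphi$ is a theorem if $\emptyset\vdash_{\mathbf{vD}}\varphi$. *)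

theory Defs
  imports Main "HOL-Library.Countable_Set"
begin

datatype 'v fm =
    Var 'v
  | And "'v fm" "'v fm"  (infixr "\<^bold>\<and>" 75)
  | Or "'v fm" "'v fm"  (infixr "\<^bold>\<or>" 70)
  | Imp "'v fm" "'v fm"  (infixr "\<^bold>\<longrightarrow>" 65)
  | Neg "'v fm"  ("\<^bold>\<not> _" [80] 80)
  | Circ "'v fm"  ("\<^bold>\<circ> _" [80] 80)

text \<open>The formula \<open>b\<close> plays the role of the fixed formula $\beta_0$.\<close>

definition Bot :: "'v fm \<Rightarrow> 'v fm"  ("\<^bold>\<bottom>\<^bsub>_\<^esub>") where
  "\<^bold>\<bottom>\<^bsub>b\<^esub> = b \<^bold>\<and> (\<^bold>\<not> b \<^bold>\<and> \<^bold>\<circ> b)"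

definition Sneg :: "'v fm \<Rightarrow> 'v fm \<Rightarrow> 'v fm"  ("\<^bold>\<sim>\<^bsub>_\<^esub> _" [0, 80] 80) where
  "\<^bold>\<sim>\<^bsub>b\<^esub> \<alpha> = \<alpha> \<^bold>\<longrightarrow> \<^bold>\<bottom>\<^bsub>b\<^esub>"

inductive vD_axiom :: "'v fm \<Rightarrow> 'v fm \<Rightarrow> bool" for b :: "'v fm" where
  Ax1: "vD_axiom b (\<alpha> \<^bold>\<longrightarrow> (\<beta> \<^bold>\<longrightarrow> \<alpha>))"
| Ax2: "vD_axiom b ((\<alpha> \<^bold>\<longrightarrow> (\<beta> \<^bold>\<longrightarrow> \<gamma>)) \<^bold>\<longrightarrow> ((\<alpha> \<^bold>\<longrightarrow> \<beta>) \<^bold>\<longrightarrow> (\<alpha> \<^bold>\<longrightarrow> \<gamma>)))"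
| Ax3: "vD_axiom b (\<alpha> \<^bold>\<longrightarrow> (\<beta> \<^bold>\<longrightarrow> (\<alpha> \<^bold>\<and> \<beta>)))"
| Ax4: "vD_axiom b ((\<alpha> \<^bold>\<and> \<beta>) \<^bold>\<longrightarrow> \<alpha>)"
| Ax5: "vD_axiom b ((\<alpha> \<^bold>\<and> \<beta>) \<^bold>\<longrightarrow> \<beta>)"
| Ax6: "vD_axiom b (\<alpha> \<^bold>\<longrightarrow> (\<alpha> \<^bold>\<or> \<beta>))"
| Ax7: "vD_axiom b (\<beta> \<^bold>\<longrightarrow> (\<alpha> \<^bold>\<or> \<beta>))"
| Ax8: "vD_axiom b ((\<alpha> \<^bold>\<longrightarrow> \<beta>) \<^bold>\<or> \<alpha>)"
| Ax9: "vD_axiom b (\<alpha> \<^bold>\<or> \<^bold>\<not> \<alpha>)"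
| Ax10: "vD_axiom b ((\<alpha> \<^bold>\<longrightarrow> \<gamma>) \<^bold>\<longrightarrow> ((\<^bold>\<not> \<alpha> \<^bold>\<longrightarrow> \<gamma>) \<^bold>\<longrightarrow> ((\<alpha> \<^bold>\<or> \<^bold>\<not> \<alpha>) \<^bold>\<longrightarrow> \<gamma>)))"
| Ax11: "vD_axiom b (((\<alpha> \<^bold>\<longrightarrow> \<beta>) \<^bold>\<longrightarrow> \<gamma>) \<^bold>\<longrightarrow>
    ((\<alpha> \<^bold>\<longrightarrow> \<gamma>) \<^bold>\<longrightarrow> (((\<alpha> \<^bold>\<longrightarrow> \<beta>) \<^bold>\<or> \<alpha>) \<^bold>\<longrightarrow> \<gamma>)))"
| Ax12: "vD_axiom b (\<^bold>\<circ> \<alpha> \<^bold>\<longrightarrow> (\<alpha> \<^bold>\<longrightarrow> (\<^bold>\<not> \<alpha> \<^bold>\<longrightarrow> \<beta>)))"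
| Ax13: "vD_axiom b (\<^bold>\<circ> \<alpha> \<^bold>\<or> (\<alpha> \<^bold>\<and> \<^bold>\<not> \<alpha>))"
| Ax14: "vD_axiom b ((\<^bold>\<circ> \<alpha> \<^bold>\<longrightarrow> \<gamma>) \<^bold>\<longrightarrow>
    (((\<alpha> \<^bold>\<and> \<^bold>\<not> \<alpha>) \<^bold>\<longrightarrow> \<gamma>) \<^bold>\<longrightarrow> ((\<^bold>\<circ> \<alpha> \<^bold>\<or> (\<alpha> \<^bold>\<and> \<^bold>\<not> \<alpha>)) \<^bold>\<longrightarrow> \<gamma>)))"
| Ax15: "vD_axiom b (\<^bold>\<sim>\<^bsub>b\<^esub> \<^bold>\<not> \<alpha> \<^bold>\<longrightarrow> \<^bold>\<sim>\<^bsub>b\<^esub> \<^bold>\<not> \<^bold>\<sim>\<^bsub>b\<^esub> \<^bold>\<not> \<alpha>)"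
| Ax16: "vD_axiom b (\<^bold>\<sim>\<^bsub>b\<^esub> \<^bold>\<not> \<^bold>\<sim>\<^bsub>b\<^esub> \<^bold>\<not> \<alpha> \<^bold>\<longrightarrow> \<^bold>\<sim>\<^bsub>b\<^esub> \<^bold>\<not> \<alpha>)"
| Ax17: "vD_axiom b (\<^bold>\<sim>\<^bsub>b\<^esub> \<^bold>\<not> (\<alpha> \<^bold>\<and> \<beta>) \<^bold>\<longrightarrow> (\<^bold>\<sim>\<^bsub>b\<^esub> \<^bold>\<not> \<alpha> \<^bold>\<and> \<^bold>\<sim>\<^bsub>b\<^esub> \<^bold>\<not> \<beta>))"
| Ax18: "vD_axiom b ((\<^bold>\<sim>\<^bsub>b\<^esub> \<^bold>\<not> \<alpha> \<^bold>\<and> \<^bold>\<sim>\<^bsub>b\<^esub> \<^bold>\<not> \<beta>) \<^bold>\<longrightarrow> \<^bold>\<sim>\<^bsub>b\<^esub> \<^bold>\<not> (\<alpha> \<^bold>\<and> \<beta>))"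

text \<open>
  Rule (N) refers to theoremhood, that is, to derivability from the empty set, so
  derivations and theorems are defined by one simultaneous induction: the list \<open>\<psi>s\<close>
  below witnesses that \<open>\<alpha>\<close>, which must occur earlier in \<open>\<phi>s\<close>, is a theorem.
  The list \<open>[]\<close> only starts the construction; \<open>vD_derives\<close> excludes it.
\<close>

inductive vD_derivation :: "'v fm \<Rightarrow> 'v fm set \<Rightarrow> 'v fm list \<Rightarrow> bool" for b :: "'v fm" where
  Start: "vD_derivation b \<Gamma> []"
| Axiom: "vD_derivation b \<Gamma> \<phi>s \<Longrightarrow> vD_axiom b \<phi> \<Longrightarrow> vD_derivation b \<Gamma> (\<phi>s @ [\<phi>])"
| Premise: "vD_derivation b \<Gamma> \<phi>s \<Longrightarrow> \<phi> \<in> \<Gamma> \<Longrightarrow> vD_derivation b \<Gamma> (\<phi>s @ [\<phi>])"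
| MP: "vD_derivation b \<Gamma> \<phi>s \<Longrightarrow> \<alpha> \<in> set \<phi>s \<Longrightarrow> \<alpha> \<^bold>\<longrightarrow> \<phi> \<in> set \<phi>s \<Longrightarrow>
    vD_derivation b \<Gamma> (\<phi>s @ [\<phi>])"
| N: "vD_derivation b \<Gamma> \<phi>s \<Longrightarrow> \<alpha> \<in> set \<phi>s \<Longrightarrow>
    vD_derivation b {} \<psi>s \<Longrightarrow> \<psi>s \<noteq> [] \<Longrightarrow> last \<psi>s = \<alpha> \<Longrightarrow>
    vD_derivation b \<Gamma> (\<phi>s @ [\<^bold>\<not> \<alpha> \<^bold>\<longrightarrow> \<^bold>\<sim>\<^bsub>b\<^esub> \<alpha>])"

definition vD_derives :: "'v fm set \<Rightarrow> 'v fm \<Rightarrow> 'v fm \<Rightarrow> bool"  ("_ \<turnstile>\<^bsub>_\<^esub> _" [51, 0, 51] 50) where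
  "\<Gamma> \<turnstile>\<^bsub>b\<^esub> \<phi> \<longleftrightarrow> (\<exists>\<phi>s. vD_derivation b \<Gamma> \<phi>s \<and> \<phi>s \<noteq> [] \<and> last \<phi>s = \<phi>)"

definition vD_theorem :: "'v fm \<Rightarrow> 'v fm \<Rightarrow> bool" where
  "vD_theorem b \<phi> \<longleftrightarrow> {} \<turnstile>\<^bsub>b\<^esub> \<phi>"

lemma vD_derivation_snoc_iff:
  "vD_derivation b \<Gamma> (\<phi>s @ [\<phi>]) \<longleftrightarrow> vD_derivation b \<Gamma> \<phi>s \<and>
    (vD_axiom b \<phi> \<or> \<phi> \<in> \<Gamma> \<or> (\<exists>\<alpha>\<in>set \<phi>s. \<alpha> \<^bold>\<longrightarrow> \<phi> \<in> set \<phi>s) \<or>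
     (\<exists>\<alpha>\<in>set \<phi>s. vD_theorem b \<alpha> \<and> \<phi> = \<^bold>\<not> \<alpha> \<^bold>\<longrightarrow> \<^bold>\<sim>\<^bsub>b\<^esub> \<alpha>))"
  unfolding vD_theorem_def vD_derives_def
  by (rule iffI, erule vD_derivation.cases) (auto intro: vD_derivation.intros)

text \<open>The index-wise description of derivations.\<close>

lemma vD_derivation_iff_nth:
  "vD_derivation b \<Gamma> \<phi>s \<longleftrightarrow> (\<forall>i<length \<phi>s.
     vD_axiom b (\<phi>s ! i) \<or> \<phi>s ! i \<in> \<Gamma> \<or>
     (\<exists>j<i. \<exists>k<i. \<phi>s ! k = \<phi>s ! j \<^bold>\<longrightarrow> \<phi>s ! i) \<or>
     (\<exists>j<i. vD_theorem b (\<phi>s ! j) \<and> \<phi>s ! i = \<^bold>\<not> (\<phi>s ! j) \<^bold>\<longrightarrow> \<^bold>\<sim>\<^bsub>b\<^esub> (\<phi>s ! j)))"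
proof (induction \<phi>s rule: rev_induct)
  case Nil
  show ?case by (simp add: vD_derivation.Start)
next
  case (snoc \<phi> \<phi>s)
  have mp: "(\<exists>\<alpha>\<in>set \<phi>s. \<alpha> \<^bold>\<longrightarrow> \<phi> \<in> set \<phi>s) \<longleftrightarrow>
    (\<exists>j<length \<phi>s. \<exists>k<length \<phi>s. \<phi>s ! k = \<phi>s ! j \<^bold>\<longrightarrow> \<phi>)"
    by (metis in_set_conv_nth)
  have n: "(\<exists>\<alpha>\<in>set \<phi>s. vD_theorem b \<alpha> \<and> \<phi> = \<^bold>\<not> \<alpha> \<^bold>\<longrightarrow> \<^bold>\<sim>\<^bsub>b\<^esub> \<alpha>) \<longleftrightarrow>
    (\<exists>j<length \<phi>s. vD_theorem b (\<phi>s ! j) \<and> \<phi> = \<^bold>\<not> (\<phi>s ! j) \<^bold>\<longrightarrow> \<^bold>\<sim>\<^bsub>b\<^esub> (\<phi>s ! j))"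
    by (metis in_set_conv_nth)
  show ?case
    unfolding vD_derivation_snoc_iff snoc.IH mp n
    by (simp add: All_less_Suc nth_append conj_commute cong: conj_cong)
qed

end

theory Submission
  imports Defs
begin

text \<open>Discharging \<alpha> is an induction along a derivation from
  \<open>\<Gamma> \<union> {\<alpha>}\<close>, prefixing every member with \<alpha>
  (\<open>vD_derivation_discharge\<close>). Axioms and members of \<Gamma> are weakened by
  \<open>Ax1\<close>, \<alpha> itself becomes an instance of reflexivity, and modus ponens is
  carried under the prefix by \<open>Ax2\<close>. Rule (N) is harmless because it acts on theorems
  only: its conclusion already follows from \<Gamma> (\<open>vD_derives_N\<close>) and can be
  weakened like an axiom. The converse is monotonicity followed by one modus ponens.\<close>

lemma vD_derives_iff_snoc: "\<Gamma> \<turnstile>\<^bsub>b\<^esub> \<phi> \<longleftrightarrow> (\<exists>\<phi>s. vD_derivation b \<Gamma> (\<phi>s @ [\<phi>]))"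
  unfolding vD_derives_def by (metis append_butlast_last_id last_snoc snoc_eq_iff_butlast)

text \<open>Each step is justified by the set of earlier members, which a prefix only enlarges. This
  lets \<open>vD_derives_MP\<close> combine two separate derivations.\<close>

lemma vD_derivation_append:
  assumes "vD_derivation b \<Gamma> \<phi>s" and "vD_derivation b \<Gamma> \<psi>s"
  shows "vD_derivation b \<Gamma> (\<phi>s @ \<psi>s)"
  using assms(2)
proof (induction \<psi>s rule: rev_induct)
  case Nil
  show ?case using assms(1) by simp
next
  case (snoc \<psi> \<psi>s)
  then have "vD_derivation b \<Gamma> ((\<phi>s @ \<psi>s) @ [\<psi>])"
    unfolding vD_derivation_snoc_iff by auto
  then show ?case by simp
qed

text \<open>The side condition of (N) speaks of derivability from the empty set, so changing the
  premises does not affect it.\<close>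

lemma vD_derivation_mono:
  assumes "vD_derivation b \<Gamma> \<phi>s" and "\<Gamma> \<subseteq> \<Delta>"
  shows "vD_derivation b \<Delta> \<phi>s"
  using assms(1)
proof (induction \<phi>s rule: rev_induct)
  case Nil
  show ?case by (rule vD_derivation.Start)
next
  case (snoc \<phi> \<phi>s)
  then show ?case
    using assms(2) unfolding vD_derivation_snoc_iff by blast
qed

lemma vD_derives_mono: "\<Gamma> \<turnstile>\<^bsub>b\<^esub> \<phi> \<Longrightarrow> \<Gamma> \<subseteq> \<Delta> \<Longrightarrow> \<Delta> \<turnstile>\<^bsub>b\<^esub> \<phi>"
  unfolding vD_derives_iff_snoc using vD_derivation_mono by blast

lemma vD_derives_axiom: "vD_axiom b \<phi> \<Longrightarrow> \<Gamma> \<turnstile>\<^bsub>b\<^esub> \<phi>"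
  unfolding vD_derives_iff_snoc by (blast intro: vD_derivation.Start vD_derivation.Axiom)

lemma vD_derives_premise: "\<phi> \<in> \<Gamma> \<Longrightarrow> \<Gamma> \<turnstile>\<^bsub>b\<^esub> \<phi>"
  unfolding vD_derives_iff_snoc by (blast intro: vD_derivation.Start vD_derivation.Premise)

lemma vD_derives_MP:
  assumes "\<Gamma> \<turnstile>\<^bsub>b\<^esub> \<alpha> \<^bold>\<longrightarrow> \<beta>" and "\<Gamma> \<turnstile>\<^bsub>b\<^esub> \<alpha>"
  shows "\<Gamma> \<turnstile>\<^bsub>b\<^esub> \<beta>"
proof -
  obtain \<phi>s \<psi>s where "vD_derivation b \<Gamma> (\<phi>s @ [\<alpha> \<^bold>\<longrightarrow> \<beta>])" "vD_derivation b \<Gamma> (\<psi>s @ [\<alpha>])"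
    using assms unfolding vD_derives_iff_snoc by blast
  then have "vD_derivation b \<Gamma> ((\<phi>s @ [\<alpha> \<^bold>\<longrightarrow> \<beta>]) @ (\<psi>s @ [\<alpha>]))"
    by (rule vD_derivation_append)
  then have "vD_derivation b \<Gamma> (((\<phi>s @ [\<alpha> \<^bold>\<longrightarrow> \<beta>]) @ (\<psi>s @ [\<alpha>])) @ [\<beta>])"
    by (rule vD_derivation.MP[where \<alpha> = \<alpha>]) auto
  then show ?thesis unfolding vD_derives_iff_snoc by blast
qed

lemma vD_derives_N:
  assumes "vD_theorem b \<alpha>"
  shows "\<Gamma> \<turnstile>\<^bsub>b\<^esub> \<^bold>\<not> \<alpha> \<^bold>\<longrightarrow> \<^bold>\<sim>\<^bsub>b\<^esub> \<alpha>"
proof -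
  \<comment> \<open>(N) demands that \<alpha> occur earlier in the same derivation, so the proof of
    the theorem is first replayed over \<Gamma>.\<close>
  have "\<Gamma> \<turnstile>\<^bsub>b\<^esub> \<alpha>"
    using assms unfolding vD_theorem_def by (rule vD_derives_mono) simp
  then obtain \<phi>s where "vD_derivation b \<Gamma> (\<phi>s @ [\<alpha>])"
    unfolding vD_derives_iff_snoc by blast
  then have "vD_derivation b \<Gamma> ((\<phi>s @ [\<alpha>]) @ [\<^bold>\<not> \<alpha> \<^bold>\<longrightarrow> \<^bold>\<sim>\<^bsub>b\<^esub> \<alpha>])"
    using assms unfolding vD_derivation_snoc_iff[of b \<Gamma> "\<phi>s @ [\<alpha>]"] by auto
  then show ?thesis unfolding vD_derives_iff_snoc by blast
qed

lemma vD_derives_weaken: "\<Gamma> \<turnstile>\<^bsub>b\<^esub> \<phi> \<Longrightarrow> \<Gamma> \<turnstile>\<^bsub>b\<^esub> \<alpha> \<^bold>\<longrightarrow> \<phi>"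
  by (rule vD_derives_MP[OF vD_derives_axiom[OF Ax1]])

lemma vD_derives_Imp_MP:
  "\<Gamma> \<turnstile>\<^bsub>b\<^esub> \<alpha> \<^bold>\<longrightarrow> (\<beta> \<^bold>\<longrightarrow> \<gamma>) \<Longrightarrow> \<Gamma> \<turnstile>\<^bsub>b\<^esub> \<alpha> \<^bold>\<longrightarrow> \<beta> \<Longrightarrow> \<Gamma> \<turnstile>\<^bsub>b\<^esub> \<alpha> \<^bold>\<longrightarrow> \<gamma>"
  by (rule vD_derives_MP[OF vD_derives_MP[OF vD_derives_axiom[OF Ax2]]])

text \<open>The combinator identity I = SKK: \<open>Ax2\<close> applied to two instances of
  \<open>Ax1\<close>.\<close>

lemma vD_derives_Imp_refl: "\<Gamma> \<turnstile>\<^bsub>b\<^esub> \<alpha> \<^bold>\<longrightarrow> \<alpha>"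
  by (rule vD_derives_Imp_MP[OF vD_derives_axiom[OF Ax1] vD_derives_axiom[OF Ax1]])

text \<open>Ranging over all members, not just the last, makes the induction hypothesis available
  for both premises of modus ponens.\<close>

lemma vD_derivation_discharge:
  assumes "vD_derivation b (\<Gamma> \<union> {\<alpha>}) \<phi>s" and "\<phi> \<in> set \<phi>s"
  shows "\<Gamma> \<turnstile>\<^bsub>b\<^esub> \<alpha> \<^bold>\<longrightarrow> \<phi>"
  using assms
proof (induction \<phi>s arbitrary: \<phi> rule: rev_induct)
  case Nil
  then show ?case by simp
next
  case (snoc \<psi> \<psi>s)
  have IH: "\<Gamma> \<turnstile>\<^bsub>b\<^esub> \<alpha> \<^bold>\<longrightarrow> \<chi>" if "\<chi> \<in> set \<psi>s" for \<chi>
    using snoc.IH snoc.prems(1) that unfolding vD_derivation_snoc_iff by blast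
  \<comment> \<open>The five ways to justify the last member, with the premise case split according
    to whether the premise is the one being discharged.\<close>
  consider "vD_axiom b \<psi>" | "\<psi> \<in> \<Gamma>" | "\<psi> = \<alpha>"
    | \<chi> where "\<chi> \<in> set \<psi>s" "\<chi> \<^bold>\<longrightarrow> \<psi> \<in> set \<psi>s"
    | \<chi> where "vD_theorem b \<chi>" "\<psi> = \<^bold>\<not> \<chi> \<^bold>\<longrightarrow> \<^bold>\<sim>\<^bsub>b\<^esub> \<chi>"
    using snoc.prems(1) unfolding vD_derivation_snoc_iff by blast
  then have "\<Gamma> \<turnstile>\<^bsub>b\<^esub> \<alpha> \<^bold>\<longrightarrow> \<psi>"
  proof cases
    case 1
    then show ?thesis by (intro vD_derives_weaken vD_derives_axiom)
  next
    case 2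
    then show ?thesis by (intro vD_derives_weaken vD_derives_premise)
  next
    case 3
    then show ?thesis by (simp add: vD_derives_Imp_refl)
  next
    case 4
    then show ?thesis by (blast intro: vD_derives_Imp_MP IH)
  next
    \<comment> \<open>The premise of (N) is a theorem, so its conclusion is derivable without \<open>\<alpha>\<close>.\<close>
    case 5
    then show ?thesis by (simp add: vD_derives_weaken vD_derives_N)
  qed
  then show ?case using snoc.prems(2) IH by auto
qed

theorem theorem2p7:
  fixes b :: "'v fm" and \<Gamma> :: "'v fm set" and \<alpha> \<beta> :: "'v fm"
  assumes "countable (UNIV :: 'v set)" and "infinite (UNIV :: 'v set)"
  shows "\<Gamma> \<union> {\<alpha>} \<turnstile>\<^bsub>b\<^esub> \<beta> \<longleftrightarrow> \<Gamma> \<turnstile>\<^bsub>b\<^esub> \<alpha> \<^bold>\<longrightarrow> \<beta>"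
proof
  assume "\<Gamma> \<union> {\<alpha>} \<turnstile>\<^bsub>b\<^esub> \<beta>"
  then show "\<Gamma> \<turnstile>\<^bsub>b\<^esub> \<alpha> \<^bold>\<longrightarrow> \<beta>"
    \<comment> \<open>The instance unfolds the assumption but not the goal; \<beta> is then the last
      member of the derivation obtained.\<close>
    unfolding vD_derives_iff_snoc[of "\<Gamma> \<union> {\<alpha>}"] by (auto intro: vD_derivation_discharge)
next
  assume "\<Gamma> \<turnstile>\<^bsub>b\<^esub> \<alpha> \<^bold>\<longrightarrow> \<beta>"
  then have "\<Gamma> \<union> {\<alpha>} \<turnstile>\<^bsub>b\<^esub> \<alpha> \<^bold>\<longrightarrow> \<beta>"
    by (rule vD_derives_mono) blast
  moreover have "\<Gamma> \<union> {\<alpha>} \<turnstile>\<^bsub>b\<^esub> \<alpha>"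
    by (rule vD_derives_premise) simp
  ultimately show "\<Gamma> \<union> {\<alpha>} \<turnstile>\<^bsub>b\<^esub> \<beta>"
    by (rule vD_derives_MP)
qed

end
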